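(* Let $T>0$, $\gamma\in(1/2,1)$, $\kappa\in(0,1)$ with $\gamma(\kappa+1)<1$, and let $\sigma^1,\dots,\sigma^d$, $x$, $a$, $y$, $\tau$ and the sequences $(\lambda_k)$, $(q_k)$ be as in the context. Assume there exists $\varepsilon_1>0$ such that, for $\gamma_1=\gamma+\varepsilon_1$, $\|x\|_{\gamma_1}<\infty$ and $\gamma_1+\gamma\kappa<1$. Put $\alpha:=\frac{1-\kappa}{\gamma}$. Then: (i) There exist constants $c_{0,x},c_{1,x}>0$ (not depending on $k,s,t$) such that for all $k$ and all $s,t\in[\lambda_k,\lambda_{k+1})$ satisfying $|t-s|\le c_{0,x}\,2^{-\alpha q_k}$ one has $$|y_t-y_s|\le c_{1,x}\,2^{-q_k\kappa}\,|t-s|^\gamma.$$ (ii) There is a constant $c_{2,x}$ (not depending on $k,s,t$) such that, for all $k$ and all $s<t$ in $[\lambda_k,\lambda_{k+1})$ with $|t-s|\le c_{0,x}\,2^{-\alpha q_k}$, $$y_t-y_s=\sum_{j=1}^d\sigma^j(y_s)\,(x^j_t-x^j_s)+r_{st},\qquad\text{with}\qquad|r_{st}|\le c_{2,x}\,2^{-\kappa_{\varepsilon_1}q_k}\,|t-s|^\gamma,$$ where $\kappa_{\varepsilon_1}=\kappa+\varepsilon_1\alpha$.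
   Context: Coefficients: $\sigma^1,\dots,\sigma^d:\mathbb{R}^m\to\mathbb{R}^m$ satisfy, for each $j$: $\sigma^j(0)=0$ and $|\sigma^j(\xi_2)-\sigma^j(\xi_1)|\le C\,||\xi_2|^\kappa-|\xi_1|^\kappa|$ for all $\xi_1,\xi_2$ and some constant $C$; $|\sigma^j(\xi)|\ge c|\xi|^\kappa$ for all $\xi$ and some $c>0$; $\sigma^j$ is differentiable on $\{\xi\ne0\}$ with $\nabla\sigma^j$ locally Hölder continuous there of order larger than $\frac1\gamma-1$. Solution: $x\in\mathcal{C}^\gamma([0,T];\mathbb{R}^d)$, $a\in\mathbb{R}^m\setminus\{0\}$, and $y:[0,T]\to\mathbb{R}^m$ is continuous, with $\tau<T$ such that for every $t<\tau$, $y\in\mathcal{C}^\gamma([0,t];\mathbb{R}^m)$ and $y_t=a+\sum_{j=1}^d\int_0^t\sigma^j(y_u)dx^j_u$ (Young integrals); $y_s\ne0$ on $[0,\tau)$, $\lim_{t\to\tau}y_t=0$, and $y_t=0$ on $[\tau,T]$. Stopping times: let $I_{-1}=[1,\infty)$, $I_q=[2^{-(q+1)},2^{-q})$ for $q\ge0$, and $J_{-1}=[3/4,\infty)$, $J_q=[\hat a_{q+1},\hat a_q)$ for $q\ge0$, with $\hat a_q=\frac{3}{2^{q+2}}$. Set $\lambda_0=0$ and let $q_0$ be such that $|a|\in I_{q_0}$. Recursively, with $q_k$ such that $|y_{\lambda_k}|\in I_{q_k}$, set $\tau_k=\inf\{t\ge\lambda_k:|y_t|\notin I_{q_k}\}$;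 let $\hat q_k$ be such that $|y_{\tau_k}|\in J_{\hat q_k}$ (so $\hat q_k\in\{q_k,q_k-1\}$); set $\lambda_{k+1}=\inf\{t\ge\tau_k:|y_t|\notin J_{\hat q_k}\}$ and let $q_{k+1}$ be such that $|y_{\lambda_{k+1}}|\in I_{q_{k+1}}$ (so $q_{k+1}-q_k\in\{-1,0,1\}$). $\|x\|_{\gamma_1}$ is the $\gamma_1$-Hölder seminorm on $[0,T]$. *)

theory Defs
  imports "HOL-Analysis.Analysis"
begin

definition holder_seminorm :: "real \<Rightarrow> 'a::metric_space set \<Rightarrow> ('a \<Rightarrow> 'b::metric_space) \<Rightarrow> ennreal"
  where "holder_seminorm \<beta> S f =
    (SUP (s, t) \<in> {(s, t). s \<in> S \<and> t \<in> S \<and> s \<noteq> t}. ennreal (dist (f s) (f t) / dist s t powr \<beta>))"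

definition holder_on :: "real \<Rightarrow> 'a::metric_space set \<Rightarrow> ('a \<Rightarrow> 'b::metric_space) \<Rightarrow> bool"
  where "holder_on \<beta> S f \<longleftrightarrow> holder_seminorm \<beta> S f < \<infinity>"

definition locally_holder_on :: "real \<Rightarrow> 'a::metric_space set \<Rightarrow> ('a \<Rightarrow> 'b::metric_space) \<Rightarrow> bool"
  where "locally_holder_on \<beta> S f \<longleftrightarrow> (\<forall>K. compact K \<and> K \<subseteq> S \<longrightarrow> holder_on \<beta> K f)"

text \<open>The Young integral of \<open>f\<close> against \<open>g\<close> on \<open>[a, b]\<close>: the limit of the Riemann--Stieltjes
  sums, with arbitrary evaluation points \<open>\<xi>\<close>, as the mesh of the partition \<open>p\<close> tends to zero.\<close>

definition has_young_integral ::
    "(real \<Rightarrow> 'a::real_normed_vector) \<Rightarrow> (real \<Rightarrow> real) \<Rightarrow> real \<Rightarrow> real \<Rightarrow> 'a \<Rightarrow> bool"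
  where "has_young_integral f g a b I \<longleftrightarrow>
    (\<forall>\<epsilon>>0. \<exists>\<delta>>0. \<forall>(n::nat) (p::nat \<Rightarrow> real) (\<xi>::nat \<Rightarrow> real).
       p 0 = a \<and> p n = b \<and>
       (\<forall>i<n. p i \<le> p (Suc i) \<and> p (Suc i) - p i < \<delta> \<and> \<xi> i \<in> {p i..p (Suc i)}) \<longrightarrow>
       norm ((\<Sum>i<n. (g (p (Suc i)) - g (p i)) *\<^sub>R f (\<xi> i)) - I) < \<epsilon>)"

definition power_type_coefficient :: "real \<Rightarrow> real \<Rightarrow> (real^'m \<Rightarrow> real^'m) \<Rightarrow> bool"
  where "power_type_coefficient \<gamma> \<kappa> \<sigma> \<longleftrightarrow>
    \<sigma> 0 = 0 \<and>
    (\<exists>C. \<forall>\<xi>1 \<xi>2. norm (\<sigma> \<xi>2 - \<sigma> \<xi>1) \<le> C * \<bar>norm \<xi>2 powr \<kappa> - norm \<xi>1 powr \<kappa>\<bar>) \<and>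
    (\<exists>c>0. \<forall>\<xi>. norm (\<sigma> \<xi>) \<ge> c * norm \<xi> powr \<kappa>) \<and>
    (\<exists>D :: real^'m \<Rightarrow> ((real^'m) \<Rightarrow>\<^sub>L (real^'m)).
       (\<forall>\<xi>. \<xi> \<noteq> 0 \<longrightarrow> (\<sigma> has_derivative blinfun_apply (D \<xi>)) (at \<xi>)) \<and>
       (\<exists>\<beta>. \<beta> > 1 / \<gamma> - 1 \<and> locally_holder_on \<beta> (- {0}) D))"

text \<open>The requirement \<open>0 < \<tau>\<close> is implicit in \<open>y 0 = a \<noteq> 0\<close>.\<close>

definition young_solution_until ::
    "real \<Rightarrow> real \<Rightarrow> ('d::finite \<Rightarrow> real^'m \<Rightarrow> real^'m) \<Rightarrow> (real \<Rightarrow> real^'d) \<Rightarrow> real^'m \<Rightarrow>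
     (real \<Rightarrow> real^'m) \<Rightarrow> real \<Rightarrow> bool"
  where "young_solution_until T \<gamma> \<sigma> x a y \<tau> \<longleftrightarrow>
    continuous_on {0..T} y \<and> 0 < \<tau> \<and> \<tau> < T \<and>
    (\<forall>t\<in>{0..<\<tau>}. holder_on \<gamma> {0..t} y \<and>
       (\<exists>I. (\<forall>j. has_young_integral (\<lambda>u. \<sigma> j (y u)) (\<lambda>u. x u $ j) 0 t (I j)) \<and>
            y t = a + (\<Sum>j\<in>UNIV. I j))) \<and>
    (\<forall>s\<in>{0..<\<tau>}. y s \<noteq> 0) \<and>
    (y \<longlongrightarrow> 0) (at_left \<tau>) \<and>
    (\<forall>t\<in>{\<tau>..T}. y t = 0)"

text \<open>Both families are indexed by the integers \<open>q \<ge> -1\<close>; for \<open>q < -1\<close> they are empty, so that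
  membership forces \<open>q \<ge> -1\<close>.\<close>

definition I_int :: "int \<Rightarrow> real set"
  where "I_int q =
    (if q = -1 then {1..}
     else if q \<ge> 0 then {2 powr (- (real_of_int q + 1)) ..< 2 powr (- real_of_int q)}
     else {})"

definition a_hat :: "int \<Rightarrow> real"
  where "a_hat q = 3 / 2 powr (real_of_int q + 2)"

definition J_int :: "int \<Rightarrow> real set"
  where "J_int q =
    (if q = -1 then {3/4..}
     else if q \<ge> 0 then {a_hat (q + 1) ..< a_hat q}
     else {})"

definition stopping_times ::
    "real \<Rightarrow> (real \<Rightarrow> real^'m) \<Rightarrow> (nat \<Rightarrow> real) \<Rightarrow> (nat \<Rightarrow> int) \<Rightarrow> (nat \<Rightarrow> real) \<Rightarrow> (nat \<Rightarrow> int) \<Rightarrow> bool"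
  where "stopping_times T y lam q tau qhat \<longleftrightarrow>
    lam 0 = 0 \<and>
    (\<forall>k. norm (y (lam k)) \<in> I_int (q k) \<and>
         tau k = Inf {t \<in> {lam k..T}. norm (y t) \<notin> I_int (q k)} \<and>
         norm (y (tau k)) \<in> J_int (qhat k) \<and>
         lam (Suc k) = Inf {t \<in> {tau k..T}. norm (y t) \<notin> J_int (qhat k)})"

end

theory Submission
  imports Defs
begin

text \<open>
  Everything is local in the size of the solution. Write \<open>b = 2\<^sup>-\<^sup>q\<close> with \<open>q = q\<^sub>k\<close>. Between two
  consecutive stopping times the norm of \<open>y\<close> stays within constant factors of \<open>b\<close>
  (\<open>solution_size_between_stopping_times\<close>), and on that range of sizes the coefficients, although
  singular at the origin, are bounded by a multiple of \<open>b powr \<kappa>\<close> and Lipschitz with a constant of order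
  \<open>b powr (\<kappa> - 1)\<close> (\<open>power_type_coefficients_bounds\<close>). The problem is then one about a Young equation
  with Lipschitz coefficients, in which only the dependence on \<open>b\<close> has to be followed.

  Let \<open>L\<close> be a \<open>\<gamma>\<close>-Hoelder constant of \<open>y\<close> on an interval of length \<open>h\<close>. The Young--Loeve estimate
  (\<open>young_integral_increment_bound\<close>) says that an increment of \<open>y\<close> differs from its first-order
  approximation \<open>\<Sum>\<^sub>j \<sigma>\<^sup>j(y\<^sub>s) (x\<^sup>j\<^sub>t - x\<^sup>j\<^sub>s)\<close> by at most a multiple of
  \<open>b powr (\<kappa> - 1) * L * h powr (\<gamma> + \<beta>)\<close>, where \<open>\<beta>\<close> is any Hoelder exponent of \<open>x\<close> with
  \<open>\<gamma> + \<beta> > 1\<close>. It is used for two values of \<open>\<beta>\<close>.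

  With \<open>\<beta> = \<gamma>\<close> the remainder is at most \<open>L / 2 * h powr \<gamma>\<close> as soon as \<open>b powr (\<kappa> - 1) * h powr \<gamma>\<close> is
  small, that is, \<open>h \<le> c\<^sub>0 * b powr \<alpha>\<close> with \<open>\<alpha> \<gamma> = 1 - \<kappa>\<close>. The first-order term has Hoelder constant of
  order \<open>b powr \<kappa>\<close>, so \<open>L\<close> can be absorbed (\<open>holder_bound_absorb\<close>), and the first estimate follows with
  \<open>L\<close> of order \<open>b powr \<kappa>\<close>.

  With \<open>\<beta> = \<gamma>\<^sub>1\<close> and this value of \<open>L\<close> the remainder is of order
  \<open>b powr (2 * \<kappa> - 1) * h powr \<gamma>\<^sub>1 * h powr \<gamma>\<close>. Since \<open>\<alpha> \<gamma>\<^sub>1 = 1 - \<kappa> + \<epsilon>\<^sub>1 \<alpha>\<close>, the same restriction on \<open>h\<close>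
  turns \<open>h powr \<gamma>\<^sub>1\<close> into \<open>b powr (1 - \<kappa> + \<epsilon>\<^sub>1 \<alpha>)\<close>, and the powers of \<open>b\<close> add up to
  \<open>\<kappa> + \<epsilon>\<^sub>1 \<alpha>\<close>, which is the second estimate.
\<close>

section \<open>Hoelder bounds\<close>

lemma holder_onE:
  fixes f :: "'a::metric_space \<Rightarrow> 'b::metric_space"
  assumes "holder_on \<beta> S f"
  obtains L where "L > 0" "\<And>s t. s \<in> S \<Longrightarrow> t \<in> S \<Longrightarrow> dist (f s) (f t) \<le> L * dist s t powr \<beta>"
proof -
  obtain L where L: "L \<ge> 0" "holder_seminorm \<beta> S f = ennreal L"
    using assms unfolding holder_on_def by (cases "holder_seminorm \<beta> S f") auto
  have "dist (f s) (f t) \<le> (L + 1) * dist s t powr \<beta>" if "s \<in> S" "t \<in> S" for s t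
  proof (cases "s = t")
    case False
    have "ennreal (dist (f s) (f t) / dist s t powr \<beta>) \<le> holder_seminorm \<beta> S f"
      unfolding holder_seminorm_def using that False by (intro SUP_upper2[of "(s, t)"]) auto
    then have "dist (f s) (f t) / dist s t powr \<beta> \<le> L"
      using L by (simp add: ennreal_le_iff)
    then have "dist (f s) (f t) \<le> L * dist s t powr \<beta>"
      using False by (simp add: divide_simps)
    then show ?thesis
      by (smt (verit) mult_right_mono powr_ge_zero)
  qed auto
  with L show thesis
    by (intro that[of "L + 1"]) auto
qed

text \<open>
  The optimal Hoelder constant \<open>L\<close> satisfies \<open>L \<le> A + L / 2\<close>. This gives \<open>L \<le> 2 * A\<close> provided that
  \<open>L\<close> is finite in the first place, which is what the a priori bound with \<open>M\<close> is for.
\<close>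

lemma holder_bound_absorb:
  fixes f :: "real \<Rightarrow> 'a::real_normed_vector"
  assumes fin: "\<And>u v. s \<le> u \<Longrightarrow> u < v \<Longrightarrow> v \<le> t \<Longrightarrow> norm (f v - f u) \<le> M * (v - u) powr \<beta>"
    and half: "\<And>L u v. L \<ge> 0 \<Longrightarrow>
      (\<And>u v. s \<le> u \<Longrightarrow> u < v \<Longrightarrow> v \<le> t \<Longrightarrow> norm (f v - f u) \<le> L * (v - u) powr \<beta>) \<Longrightarrow>
      s \<le> u \<Longrightarrow> u < v \<Longrightarrow> v \<le> t \<Longrightarrow> norm (f v - f u) \<le> (A + L / 2) * (v - u) powr \<beta>"
    and uv: "s \<le> u" "u < v" "v \<le> t"
  shows "norm (f v - f u) \<le> 2 * A * (v - u) powr \<beta>"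
proof -
  define Q where "Q = {norm (f v - f u) / (v - u) powr \<beta> | u v. s \<le> u \<and> u < v \<and> v \<le> t}"
  define L where "L = Sup Q"
  have "bdd_above Q"
    unfolding Q_def using fin by (intro bdd_aboveI[of _ M]) (auto simp: pos_divide_le_eq)
  then have up: "norm (f v - f u) / (v - u) powr \<beta> \<le> L" if "s \<le> u" "u < v" "v \<le> t" for u v
    unfolding L_def using that by (intro cSup_upper) (auto simp: Q_def)
  have "L \<ge> 0"
    using up[OF uv] by (rule order_trans[rotated]) simp
  moreover have "norm (f v - f u) \<le> L * (v - u) powr \<beta>" if "s \<le> u" "u < v" "v \<le> t" for u v
    using up[OF that] that by (simp add: divide_simps)
  ultimately have *: "norm (f v - f u) \<le> (A + L / 2) * (v - u) powr \<beta>"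
    if "s \<le> u" "u < v" "v \<le> t" for u v
    using half that by blast
  have "L \<le> A + L / 2"
    unfolding L_def
  proof (rule cSup_least)
    show "Q \<noteq> {}" using uv by (auto simp: Q_def)
    fix r assume "r \<in> Q"
    then obtain u v where "r = norm (f v - f u) / (v - u) powr \<beta>" "s \<le> u" "u < v" "v \<le> t"
      by (auto simp: Q_def)
    with *[of u v] show "r \<le> A + Sup Q / 2"
      unfolding L_def[symmetric] by (simp add: pos_divide_le_eq)
  qed
  then have "A + L / 2 \<le> 2 * A" by simp
  then show ?thesis
    using *[OF uv] by (meson mult_right_mono order_trans powr_ge_zero)
qed

section \<open>The Young--Loeve estimate\<close>

definition uniform_partition :: "real \<Rightarrow> real \<Rightarrow> nat \<Rightarrow> nat \<Rightarrow> real"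
  where "uniform_partition s t n i = s + real i * (t - s) / real n"

text \<open>Left endpoints suffice: a Young integral is the limit of these sums in particular, and they are
  the ones that behave well under bisection.\<close>

definition left_sum ::
    "(real \<Rightarrow> 'a::real_normed_vector) \<Rightarrow> (real \<Rightarrow> real) \<Rightarrow> (nat \<Rightarrow> real) \<Rightarrow> nat \<Rightarrow> 'a"
  where "left_sum f g p n = (\<Sum>i<n. (g (p (Suc i)) - g (p i)) *\<^sub>R f (p i))"

lemma sum_lessThan_add:
  fixes F :: "nat \<Rightarrow> 'a::comm_monoid_add"
  shows "(\<Sum>i<m + n. F i) = (\<Sum>i<m. F i) + (\<Sum>i<n. F (m + i))"
  by (induction n) (auto simp: add.assoc)

lemma left_sum_concat:
  assumes "p1 m = p2 0"
  shows "left_sum f g (\<lambda>i. if i \<le> m then p1 i else p2 (i - m)) (m + n) =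
    left_sum f g p1 m + left_sum f g p2 n"
  unfolding left_sum_def sum_lessThan_add using assms
  by (intro arg_cong2[where f="(+)"] sum.cong) (auto simp: Suc_diff_le)

lemma left_sum_uniform_bisect:
  assumes "n > 0"
  shows "left_sum f g (uniform_partition s t (2 * n)) (2 * n) =
    left_sum f g (uniform_partition s ((s + t) / 2) n) n +
    left_sum f g (uniform_partition ((s + t) / 2) t n) n"
proof -
  have "uniform_partition s t (2 * n) =
    (\<lambda>i. if i \<le> n then uniform_partition s ((s + t) / 2) n i
         else uniform_partition ((s + t) / 2) t n (i - n))"
    using assms by (auto simp: uniform_partition_def fun_eq_iff field_simps of_nat_diff)
  moreover have "uniform_partition s ((s + t) / 2) n n = uniform_partition ((s + t) / 2) t n 0"
    using assms by (simp add: uniform_partition_def field_simps)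
  ultimately show ?thesis
    using left_sum_concat[of "uniform_partition s ((s + t) / 2) n" n
      "uniform_partition ((s + t) / 2) t n" f g n] by (simp add: mult_2)
qed

text \<open>
  Induction on the number of bisections. Halving \<open>[s, t]\<close> at \<open>m\<close> replaces \<open>f s\<close> by \<open>f m\<close> on the right half,
  at the cost of \<open>F * G * h powr \<theta>\<close>, where \<open>h = (t - s) / 2\<close> and \<open>\<theta> = \<beta> + \<beta>'\<close>. A bound with the constant
  \<open>C\<close> on both halves thus gives one with the constant \<open>(2 * C + F * G) / 2 powr \<theta>\<close> on \<open>[s, t]\<close>. The constant
  in the statement is the fixed point of this map, which is nonnegative exactly because \<open>\<theta> > 1\<close>.
\<close>

lemma dyadic_left_sum_bound:
  fixes f :: "real \<Rightarrow> 'a::real_normed_vector"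
  assumes "\<beta> + \<beta>' > 1" "F \<ge> 0" "G \<ge> 0"
    and "\<And>u v. s \<le> u \<Longrightarrow> u < v \<Longrightarrow> v \<le> t \<Longrightarrow> norm (f v - f u) \<le> F * (v - u) powr \<beta>"
    and "\<And>u v. s \<le> u \<Longrightarrow> u < v \<Longrightarrow> v \<le> t \<Longrightarrow> \<bar>g v - g u\<bar> \<le> G * (v - u) powr \<beta>'"
    and "s < t"
  shows "norm (left_sum f g (uniform_partition s t (2 ^ n)) (2 ^ n) - (g t - g s) *\<^sub>R f s)
    \<le> F * G / (2 powr (\<beta> + \<beta>') - 2) * (t - s) powr (\<beta> + \<beta>')"
  using assms(4-)
proof (induction n arbitrary: s t)
  case 0
  have "2 powr (\<beta> + \<beta>') > 2 powr 1"
    using assms(1) by (intro powr_less_mono) auto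
  then show ?case
    using assms(2,3) by (simp add: left_sum_def uniform_partition_def)
next
  case (Suc n)
  define \<theta> where "\<theta> = \<beta> + \<beta>'"
  define C where "C = F * G / (2 powr \<theta> - 2)"
  define m where "m = (s + t) / 2"
  define h where "h = (t - s) / 2"
  have m: "s < m" "m < t" and h: "m - s = h" "t - m = h" "h > 0" "t - s = 2 * h"
    using \<open>s < t\<close> by (auto simp: m_def h_def field_simps)
  have "2 powr \<theta> > 2 powr 1"
    using assms(1) by (intro powr_less_mono) (auto simp: \<theta>_def)
  then have C: "C * (2 powr \<theta> - 2) = F * G"
    by (simp add: C_def)
  let ?S = "\<lambda>u v. left_sum f g (uniform_partition u v (2 ^ n)) (2 ^ n)"
  have 1: "norm (?S s m - (g m - g s) *\<^sub>R f s) \<le> C * h powr \<theta>"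
    using Suc.IH[of s m] Suc.prems m h(1) by (simp add: C_def \<theta>_def)
  have 2: "norm (?S m t - (g t - g m) *\<^sub>R f m) \<le> C * h powr \<theta>"
    using Suc.IH[of m t] Suc.prems m h(2) by (simp add: C_def \<theta>_def)
  have "norm ((g t - g m) *\<^sub>R (f m - f s)) \<le> (G * h powr \<beta>') * (F * h powr \<beta>)"
    unfolding norm_scaleR using Suc.prems(1)[of s m] Suc.prems(2)[of m t] m h assms(2,3)
    by (intro mult_mono) auto
  also have "\<dots> = F * G * h powr \<theta>"
    by (simp add: \<theta>_def powr_add)
  finally have 3: "norm ((g t - g m) *\<^sub>R (f m - f s)) \<le> F * G * h powr \<theta>" .
  have "left_sum f g (uniform_partition s t (2 ^ Suc n)) (2 ^ Suc n) = ?S s m + ?S m t"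
    using left_sum_uniform_bisect[of "2 ^ n" f g s t] by (simp add: m_def)
  then have "left_sum f g (uniform_partition s t (2 ^ Suc n)) (2 ^ Suc n) - (g t - g s) *\<^sub>R f s =
    (?S s m - (g m - g s) *\<^sub>R f s) + (?S m t - (g t - g m) *\<^sub>R f m)
      + (g t - g m) *\<^sub>R (f m - f s)"
    by (simp add: algebra_simps)
  also have "norm \<dots> \<le> C * h powr \<theta> + C * h powr \<theta> + F * G * h powr \<theta>"
    using 1 2 3 by (intro norm_triangle_le add_mono) auto
  also have "\<dots> = C * (2 powr \<theta> * h powr \<theta>)"
    unfolding C[symmetric] by (simp add: algebra_simps)
  also have "\<dots> = C * (t - s) powr \<theta>"
    using h by (simp add: powr_mult)
  finally show ?case by (simp add: C_def \<theta>_def)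
qed

lemma uniform_partition_mesh:
  assumes "s \<le> t" "\<delta> > 0"
  shows "\<exists>N>0. \<forall>n\<ge>N. \<forall>i. uniform_partition s t n i \<le> uniform_partition s t n (Suc i) \<and>
    uniform_partition s t n (Suc i) - uniform_partition s t n i < \<delta>"
proof -
  obtain N :: nat where N: "(t - s) / \<delta> < real N" "N > 0"
    using reals_Archimedean2 by (metis assms diff_ge_0_iff_ge divide_nonneg_pos gr0I leD of_nat_0)
  have "uniform_partition s t n i \<le> uniform_partition s t n (Suc i) \<and>
    uniform_partition s t n (Suc i) - uniform_partition s t n i < \<delta>" if "n \<ge> N" for n i
  proof -
    have d: "uniform_partition s t n (Suc i) - uniform_partition s t n i = (t - s) / real n"
      by (simp add: uniform_partition_def add_divide_distrib diff_divide_distrib algebra_simps)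
    have n: "real n > 0" "(t - s) / \<delta> < real n"
      using that N by linarith+
    then have "0 \<le> (t - s) / real n" "(t - s) / real n < \<delta>"
      using assms by (auto simp: field_simps)
    with d show ?thesis by linarith
  qed
  with N show ?thesis by blast
qed

lemma young_integral_left_sums:
  assumes "has_young_integral f g a b I" "\<epsilon> > 0"
  obtains \<delta> where "\<delta> > 0"
    "\<And>p n. p 0 = a \<Longrightarrow> p n = b \<Longrightarrow> (\<And>i. i < n \<Longrightarrow> p i \<le> p (Suc i) \<and> p (Suc i) - p i < \<delta>) \<Longrightarrow>
       norm (left_sum f g p n - I) < \<epsilon>"
proof -
  obtain \<delta> where "\<delta> > 0" and \<delta>: "\<forall>(n::nat) (p::nat \<Rightarrow> real) (\<xi>::nat \<Rightarrow> real).
       p 0 = a \<and> p n = b \<and>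
       (\<forall>i<n. p i \<le> p (Suc i) \<and> p (Suc i) - p i < \<delta> \<and> \<xi> i \<in> {p i..p (Suc i)}) \<longrightarrow>
       norm ((\<Sum>i<n. (g (p (Suc i)) - g (p i)) *\<^sub>R f (\<xi> i)) - I) < \<epsilon>"
    using assms unfolding has_young_integral_def by meson
  show thesis
  proof (rule that)
    fix p :: "nat \<Rightarrow> real" and n
    assume "p 0 = a" "p n = b" "\<And>i. i < n \<Longrightarrow> p i \<le> p (Suc i) \<and> p (Suc i) - p i < \<delta>"
    then show "norm (left_sum f g p n - I) < \<epsilon>"
      unfolding left_sum_def by (intro \<delta>[rule_format]) simp
  qed fact
qed

text \<open>
  The Young--Loeve estimate, for the increment of an indefinite integral. A fine partition of \<open>[c, s]\<close>
  continued by a fine dyadic partition of \<open>[s, t]\<close> is a fine partition of \<open>[c, t]\<close>. Hence the difference of the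
  two integrals is approximated by dyadic sums over \<open>[s, t]\<close>, and the uniform bound on these passes to the
  limit; no integral over \<open>[s, t]\<close> has to be constructed.
\<close>

lemma young_integral_increment_bound:
  fixes f :: "real \<Rightarrow> 'a::real_normed_vector"
  assumes I: "has_young_integral f g c s Is" and J: "has_young_integral f g c t It"
    and "c \<le> s" "s < t"
    and "\<beta> + \<beta>' > 1" "F \<ge> 0" "G \<ge> 0"
    and "\<And>u v. s \<le> u \<Longrightarrow> u < v \<Longrightarrow> v \<le> t \<Longrightarrow> norm (f v - f u) \<le> F * (v - u) powr \<beta>"
    and "\<And>u v. s \<le> u \<Longrightarrow> u < v \<Longrightarrow> v \<le> t \<Longrightarrow> \<bar>g v - g u\<bar> \<le> G * (v - u) powr \<beta>'"
  shows "norm (It - Is - (g t - g s) *\<^sub>R f s)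
    \<le> F * G / (2 powr (\<beta> + \<beta>') - 2) * (t - s) powr (\<beta> + \<beta>')" (is "_ \<le> ?R")
proof (rule field_le_epsilon)
  fix e :: real assume "e > 0"
  then have e: "e / 2 > 0" by simp
  obtain \<delta>1 where d1: "\<delta>1 > 0"
    "\<And>p n. p 0 = c \<Longrightarrow> p n = s \<Longrightarrow> (\<And>i. i < n \<Longrightarrow> p i \<le> p (Suc i) \<and> p (Suc i) - p i < \<delta>1) \<Longrightarrow>
       norm (left_sum f g p n - Is) < e / 2"
    by (rule young_integral_left_sums[OF I e]) blast
  obtain \<delta>2 where d2: "\<delta>2 > 0"
    "\<And>p n. p 0 = c \<Longrightarrow> p n = t \<Longrightarrow> (\<And>i. i < n \<Longrightarrow> p i \<le> p (Suc i) \<and> p (Suc i) - p i < \<delta>2) \<Longrightarrow>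
       norm (left_sum f g p n - It) < e / 2"
    by (rule young_integral_left_sums[OF J e]) blast
  define \<delta> where "\<delta> = min \<delta>1 \<delta>2"
  have "\<delta> > 0" using d1 d2 by (simp add: \<delta>_def)
  obtain N where N: "N > 0" "\<And>i. uniform_partition c s N i \<le> uniform_partition c s N (Suc i)"
    "\<And>i. uniform_partition c s N (Suc i) - uniform_partition c s N i < \<delta>"
    using uniform_partition_mesh[OF \<open>c \<le> s\<close> \<open>\<delta> > 0\<close>] by blast
  obtain M where M: "M > 0" "\<And>i n. n \<ge> M \<Longrightarrow> uniform_partition s t n i \<le> uniform_partition s t n (Suc i)"
    "\<And>i n. n \<ge> M \<Longrightarrow> uniform_partition s t n (Suc i) - uniform_partition s t n i < \<delta>"
    using uniform_partition_mesh[OF less_imp_le[OF \<open>s < t\<close>] \<open>\<delta> > 0\<close>] by blast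
  \<comment> \<open>A power of two, as the dyadic bound requires, and large enough since \<open>M \<le> 2 ^ M\<close>.\<close>
  define K :: nat where "K = 2 ^ M"
  have "K \<ge> M" "K > 0" by (auto simp: K_def less_imp_le)
  let ?p = "uniform_partition c s N" and ?r = "uniform_partition s t K"
  let ?pr = "\<lambda>i. if i \<le> N then ?p i else ?r (i - N)"
  have ends: "?p 0 = c" "?p N = s" "?r 0 = s" "?r K = t"
    using \<open>N > 0\<close> \<open>K > 0\<close> by (auto simp: uniform_partition_def)
  have 1: "norm (left_sum f g ?p N - Is) < e / 2"
    using N ends by (intro d1(2)) (auto simp: \<delta>_def)
  have 2: "norm (left_sum f g ?pr (N + K) - It) < e / 2"
  proof (rule d2(2))
    fix i
    have r: "?r l \<le> ?r (Suc l)" "?r (Suc l) - ?r l < \<delta>2" for l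
      using M(2)[OF \<open>K \<ge> M\<close>, of l] M(3)[OF \<open>K \<ge> M\<close>, of l] by (auto simp: \<delta>_def)
    have p: "?p l \<le> ?p (Suc l)" "?p (Suc l) - ?p l < \<delta>2" for l
      using N(2)[of l] N(3)[of l] by (auto simp: \<delta>_def)
    consider "Suc i \<le> N" | "i = N" | "i > N" by linarith
    then show "?pr i \<le> ?pr (Suc i) \<and> ?pr (Suc i) - ?pr i < \<delta>2"
    proof cases
      case 1
      then show ?thesis using p[of i] by simp
    next
      case 2
      then show ?thesis using r[of 0] ends by simp
    next
      case 3
      then show ?thesis using r[of "i - N"] by (simp add: Suc_diff_le)
    qed
  qed (use ends \<open>K > 0\<close> in auto)
  have split: "left_sum f g ?pr (N + K) = left_sum f g ?p N + left_sum f g ?r K"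
    using ends by (intro left_sum_concat) auto
  have 3: "norm (left_sum f g ?r K - (g t - g s) *\<^sub>R f s) \<le> ?R"
    unfolding K_def using assms(4-) by (intro dyadic_left_sum_bound) auto
  have "norm (u + (v - w)) \<le> norm u + (norm v + norm w)" for u v w :: 'a
    by (intro order_trans[OF norm_triangle_ineq] add_left_mono norm_triangle_ineq4)
  from this[of "left_sum f g ?r K - (g t - g s) *\<^sub>R f s" "left_sum f g ?p N - Is"
      "left_sum f g ?pr (N + K) - It"]
  have "norm (It - Is - (g t - g s) *\<^sub>R f s) \<le> norm (left_sum f g ?r K - (g t - g s) *\<^sub>R f s)
      + (norm (left_sum f g ?p N - Is) + norm (left_sum f g ?pr (N + K) - It))"
    unfolding split by (simp add: algebra_simps)
  with 1 2 3 show "norm (It - Is - (g t - g s) *\<^sub>R f s) \<le> ?R + e"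
    by linarith
qed

section \<open>Power-type coefficients\<close>

text \<open>
  For \<open>m \<le> v \<le> u\<close> factor out \<open>v powr \<kappa>\<close>: the ratio \<open>u / v\<close> is at least \<open>1\<close>, so raising it to the power
  \<open>\<kappa> < 1\<close> only decreases it, and the difference is at most \<open>v powr (\<kappa> - 1) * (u - v)\<close>.
\<close>

lemma powr_diff_le:
  fixes u v m :: real
  assumes "0 < \<kappa>" "\<kappa> < 1" "0 < m" "m \<le> u" "m \<le> v"
  shows "\<bar>u powr \<kappa> - v powr \<kappa>\<bar> \<le> m powr (\<kappa> - 1) * \<bar>u - v\<bar>"
proof -
  have *: "\<bar>u powr \<kappa> - v powr \<kappa>\<bar> \<le> m powr (\<kappa> - 1) * \<bar>u - v\<bar>" if "m \<le> v" "v \<le> u" for u v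
  proof -
    have pos: "v > 0" "u > 0" using that assms by auto
    have "(u / v) powr \<kappa> \<le> (u / v) powr 1"
      using that pos assms by (intro powr_mono) auto
    then have "v powr \<kappa> * (u / v) powr \<kappa> \<le> v powr \<kappa> * (u / v)"
      using pos by (intro mult_left_mono) auto
    then have "u powr \<kappa> - v powr \<kappa> \<le> v powr \<kappa> * (u / v) - v powr \<kappa>"
      using pos by (simp add: powr_divide)
    also have "\<dots> = v powr (\<kappa> - 1) * (u - v)"
      using pos by (simp add: powr_diff field_simps)
    also have "\<dots> \<le> m powr (\<kappa> - 1) * (u - v)"
      using that assms by (intro mult_right_mono powr_mono2') auto
    finally show ?thesis
      using that pos assms by (simp add: abs_of_nonneg powr_mono2)
  qed
  show ?thesis
    using *[of v u] *[of u v] assms by (cases "v \<le> u") (auto simp: abs_minus_commute)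
qed

text \<open>
  Both bounds come from comparing \<open>\<sigma> j\<close> with \<open>norm \<xi> powr \<kappa>\<close>: growth by taking the origin, where \<open>\<sigma> j\<close>
  vanishes, as the second point, and Lipschitz continuity away from the origin from that of
  \<open>r \<mapsto> r powr \<kappa>\<close>. The constant serves all the finitely many coefficients at once.
\<close>

lemma power_type_coefficients_bounds:
  fixes \<sigma> :: "'d::finite \<Rightarrow> real^'m \<Rightarrow> real^'m"
  assumes "\<And>j. power_type_coefficient \<gamma> \<kappa> (\<sigma> j)" "0 < \<kappa>" "\<kappa> < 1"
  obtains C where "C > 0"
    "\<And>j \<xi>. norm (\<sigma> j \<xi>) \<le> C * norm \<xi> powr \<kappa>"
    "\<And>j \<xi> \<eta> m. 0 < m \<Longrightarrow> m \<le> norm \<xi> \<Longrightarrow> m \<le> norm \<eta> \<Longrightarrow>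
       norm (\<sigma> j \<xi> - \<sigma> j \<eta>) \<le> C * m powr (\<kappa> - 1) * norm (\<xi> - \<eta>)"
proof -
  have z: "\<sigma> j 0 = 0" for j
    using assms(1) by (simp add: power_type_coefficient_def)
  have "\<forall>j. \<exists>C. \<forall>\<xi> \<eta>. norm (\<sigma> j \<xi> - \<sigma> j \<eta>) \<le> C * \<bar>norm \<xi> powr \<kappa> - norm \<eta> powr \<kappa>\<bar>"
    using assms(1) unfolding power_type_coefficient_def by blast
  then obtain c where c:
    "\<And>j \<xi> \<eta>. norm (\<sigma> j \<xi> - \<sigma> j \<eta>) \<le> c j * \<bar>norm \<xi> powr \<kappa> - norm \<eta> powr \<kappa>\<bar>"
    by metis
  define C where "C = (\<Sum>j\<in>UNIV. \<bar>c j\<bar>) + 1"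
  have "C > 0"
    unfolding C_def by (meson abs_ge_zero add_nonneg_pos sum_nonneg zero_less_one)
  have cC: "c j \<le> C" for j
    using member_le_sum[of j UNIV "\<lambda>j. \<bar>c j\<bar>"] by (simp add: C_def)
  have C: "norm (\<sigma> j \<xi> - \<sigma> j \<eta>) \<le> C * \<bar>norm \<xi> powr \<kappa> - norm \<eta> powr \<kappa>\<bar>" for j \<xi> \<eta>
    using c[of j \<xi> \<eta>] mult_right_mono[OF cC[of j] abs_ge_zero] by (rule order_trans)
  show thesis
  proof
    show "norm (\<sigma> j \<xi>) \<le> C * norm \<xi> powr \<kappa>" for j \<xi>
      using C[of j \<xi> 0] assms(2) z by simp
    show "norm (\<sigma> j \<xi> - \<sigma> j \<eta>) \<le> C * m powr (\<kappa> - 1) * norm (\<xi> - \<eta>)"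
      if "0 < m" "m \<le> norm \<xi>" "m \<le> norm \<eta>" for j \<xi> \<eta> m
    proof -
      have "\<bar>norm \<xi> powr \<kappa> - norm \<eta> powr \<kappa>\<bar> \<le> m powr (\<kappa> - 1) * \<bar>norm \<xi> - norm \<eta>\<bar>"
        using that assms by (intro powr_diff_le)
      also have "\<dots> \<le> m powr (\<kappa> - 1) * norm (\<xi> - \<eta>)"
        by (intro mult_left_mono norm_triangle_ineq3) auto
      finally have "C * \<bar>norm \<xi> powr \<kappa> - norm \<eta> powr \<kappa>\<bar> \<le> C * (m powr (\<kappa> - 1) * norm (\<xi> - \<eta>))"
        using \<open>C > 0\<close> by simp
      with C[of j \<xi> \<eta>] show ?thesis by (simp add: mult.assoc)
    qed
  qed fact
qed

section \<open>The size of the solution between stopping times\<close>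

lemma I_int_bounds:
  assumes "r \<in> I_int q"
  shows "q \<ge> -1" "2 powr (- real_of_int q) / 2 \<le> r" "q \<noteq> -1 \<Longrightarrow> r \<le> 2 powr (- real_of_int q)"
proof -
  show "q \<ge> -1" using assms by (auto simp: I_int_def split: if_splits)
  show "2 powr (- real_of_int q) / 2 \<le> r"
    using assms by (auto simp: I_int_def powr_diff powr_minus divide_simps powr_add split: if_splits)
  show "q \<noteq> -1 \<Longrightarrow> r \<le> 2 powr (- real_of_int q)"
    using assms by (auto simp: I_int_def split: if_splits)
qed

text \<open>Apart from the unbounded interval \<open>J_int (-1)\<close>, the endpoints of \<open>J_int p\<close> have ratio \<open>2\<close>.\<close>

lemma J_int_ratio:
  assumes "r \<in> J_int p" "r' \<in> J_int p"
  shows "r \<le> 2 * r' \<or> p = -1 \<and> 3/4 \<le> r'"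
proof (cases "p = -1")
  case True
  with assms show ?thesis by (simp add: J_int_def)
next
  case False
  define c :: real where "c = 2 powr real_of_int p"
  have "c > 0" by (simp add: c_def)
  have "r < 3 / (c * 4)" "3 / (c * 8) \<le> r'"
    using assms False by (auto simp: J_int_def a_hat_def powr_add c_def split: if_splits)
  moreover have "3 / (c * 4) = 2 * (3 / (c * 8))" by simp
  ultimately show ?thesis by linarith
qed

lemma before_first_exit:
  fixes P :: "real \<Rightarrow> bool"
  assumes "t \<ge> l" "t < Inf {t \<in> {l..T}. \<not> P t}" "Inf {t \<in> {l..T}. \<not> P t} \<le> T"
  shows "P t"
proof (rule ccontr)
  assume "\<not> P t"
  then have "Inf {t \<in> {l..T}. \<not> P t} \<le> t"
    using assms by (intro cInf_lower bdd_belowI[of _ l]) auto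
  with assms show False by simp
qed

lemma first_exit_time_bounds:
  fixes P :: "real \<Rightarrow> bool"
  assumes "l \<le> T" "\<not> P T"
  shows "l \<le> Inf {t \<in> {l..T}. \<not> P t}" "Inf {t \<in> {l..T}. \<not> P t} \<le> T"
  using assms by (auto intro!: cInf_greatest cInf_lower bdd_belowI[of _ l])

text \<open>
  Up to \<open>tau k\<close> the norm of \<open>y\<close> lies in \<open>I_int (q k)\<close>, and by continuity its value at \<open>tau k\<close> lies in the
  closure of that interval. From then on it shares an interval \<open>J_int (qhat k)\<close> with this value, which loses
  at most one more factor \<open>2\<close>. In the unbounded intervals of index \<open>-1\<close> no upper bound comes from the
  construction; there \<open>2 powr (- q k) \<ge> 1\<close>, and the maximum of the norm of \<open>y\<close> over \<open>[0, T]\<close> serves, which is why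
  \<open>B\<close> depends on \<open>y\<close>. Every stopping time is smaller than \<open>\<tau>\<close>, because \<open>y\<close> does not vanish at the stopping
  times; as \<open>y T = 0\<close>, the infima defining them are taken over nonempty sets.
\<close>

lemma solution_size_between_stopping_times:
  fixes y :: "real \<Rightarrow> real^'m"
  assumes cont: "continuous_on {0..T} y" and "0 < \<tau>" "\<tau> < T"
    and zero: "\<And>t. t \<in> {\<tau>..T} \<Longrightarrow> y t = 0"
    and st: "stopping_times T y lam q tau qhat"
  shows "\<exists>B>0. \<forall>k. \<forall>t\<in>{lam k..<lam (Suc k)}. 0 \<le> t \<and> t < \<tau> \<and>
       2 powr (- real_of_int (q k)) / 4 \<le> norm (y t) \<and>
       norm (y t) \<le> B * 2 powr (- real_of_int (q k))"
proof -
  have st': "lam 0 = 0" "norm (y (lam k)) \<in> I_int (q k)" "norm (y (tau k)) \<in> J_int (qhat k)"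
    "tau k = Inf {t \<in> {lam k..T}. norm (y t) \<notin> I_int (q k)}"
    "lam (Suc k) = Inf {t \<in> {tau k..T}. norm (y t) \<notin> J_int (qhat k)}" for k
    using st unfolding stopping_times_def by blast+
  have zI: "0 \<notin> I_int p" and zJ: "0 \<notin> J_int p" for p
    by (auto simp: I_int_def J_int_def a_hat_def not_le)
  have "\<tau> \<le> T" "y T = 0" using zero[of T] \<open>\<tau> < T\<close> by auto
  have tauk: "lam k \<le> tau k" "tau k \<le> T" if "lam k \<le> T" for k
    using first_exit_time_bounds[of "lam k" T "\<lambda>t. norm (y t) \<in> I_int (q k)"] that zI \<open>y T = 0\<close>
    unfolding st'(4)[symmetric] by auto
  have lamk: "tau k \<le> lam (Suc k)" "lam (Suc k) \<le> T" if "tau k \<le> T" for k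
    using first_exit_time_bounds[of "tau k" T "\<lambda>t. norm (y t) \<in> J_int (qhat k)"] that zJ \<open>y T = 0\<close>
    unfolding st'(5)[symmetric] by auto
  have lam: "0 \<le> lam k \<and> lam k \<le> T" for k
  proof (induction k)
    case 0
    then show ?case using assms(2,3) st'(1) by auto
  next
    case (Suc k)
    then show ?case using tauk[of k] lamk[of k] by auto
  qed
  have order: "lam k \<le> tau k" "tau k \<le> lam (Suc k)" "tau k \<le> T" for k
    using tauk lamk lam by auto
  have lam_less: "lam k < \<tau>" for k
  proof (rule ccontr)
    assume "\<not> lam k < \<tau>"
    then have "y (lam k) = 0" using lam[of k] by (intro zero) auto
    then show False using st'(2)[of k] zI by auto
  qed
  have "bounded (y ` {0..T})"
    by (intro compact_imp_bounded compact_continuous_image cont compact_Icc)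
  then obtain B0 where B0: "\<forall>t\<in>{0..T}. norm (y t) \<le> B0"
    unfolding bounded_iff by auto
  define B where "B = max B0 2"
  have B: "norm (y t) \<le> B" if "0 \<le> t" "t \<le> T" for t
    using B0 that unfolding B_def by (meson atLeastAtMost_iff max.coboundedI1)
  have "B \<ge> 2" by (simp add: B_def)
  have phase1: "norm (y t) \<in> I_int (q k)" if "lam k \<le> t" "t < tau k" for k t
    using before_first_exit[of "lam k" t T "\<lambda>t. norm (y t) \<in> I_int (q k)"] that order[of k]
    unfolding st'(4)[symmetric] by simp
  have phase2: "norm (y t) \<in> J_int (qhat k)" if "tau k \<le> t" "t < lam (Suc k)" for k t
    using before_first_exit[of "tau k" t T "\<lambda>t. norm (y t) \<in> J_int (qhat k)"] that lam[of "Suc k"]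
    unfolding st'(5)[symmetric] by simp
  \<comment> \<open>At the exit time itself the norm of \<open>y\<close> may have left the half-open interval, but it is a limit of
    values in it.\<close>
  have attau: "norm (y (tau k)) \<in> closure (I_int (q k))" for k
  proof (cases "tau k = lam k")
    case True
    then show ?thesis using st'(2)[of k] closure_subset by auto
  next
    case False
    then have "lam k < tau k" using order[of k] by simp
    have "continuous_on (closure {lam k..<tau k}) (\<lambda>t. norm (y t))"
      using \<open>lam k < tau k\<close> order[of k] lam[of k]
      by (intro continuous_on_norm continuous_on_subset[OF cont]) auto
    then have "(\<lambda>t. norm (y t)) ` closure {lam k..<tau k} \<subseteq> closure (I_int (q k))"
      using phase1[of k] closure_subset by (intro image_closure_subset) (auto, blast)
    then show ?thesis using \<open>lam k < tau k\<close> by auto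
  qed
  have attau_bounds: "2 powr (- real_of_int (q k)) / 2 \<le> norm (y (tau k))"
    "q k \<noteq> -1 \<Longrightarrow> norm (y (tau k)) \<le> 2 powr (- real_of_int (q k))" for k
  proof -
    have "closure (I_int (q k)) \<subseteq> {2 powr (- real_of_int (q k)) / 2..}"
      using I_int_bounds(2) by (intro closure_minimal) auto
    with attau[of k] show "2 powr (- real_of_int (q k)) / 2 \<le> norm (y (tau k))" by auto
    assume "q k \<noteq> -1"
    then have "closure (I_int (q k)) \<subseteq> {..2 powr (- real_of_int (q k))}"
      using I_int_bounds(3) by (intro closure_minimal) auto
    with attau[of k] show "norm (y (tau k)) \<le> 2 powr (- real_of_int (q k))" by auto
  qed
  have main: "2 powr (- real_of_int (q k)) / 4 \<le> norm (y t) \<and>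
      norm (y t) \<le> B * 2 powr (- real_of_int (q k))"
    if t: "t \<in> {lam k..<lam (Suc k)}" for k t
  proof -
    define b where "b = 2 powr (- real_of_int (q k))"
    have "b > 0" by (simp add: b_def)
    have "q k \<ge> -1" using I_int_bounds(1) st'(2) by blast
    have yB: "norm (y t) \<le> B" using B[of t] t lam[of k] lam[of "Suc k"] by auto
    have bB: "norm (y t) \<le> B * b" if "b \<ge> 1"
      using yB mult_left_mono[OF that, of B] \<open>B \<ge> 2\<close> by linarith
    have b_small: "b * 2 \<le> B * b" using \<open>B \<ge> 2\<close> \<open>b > 0\<close> by (simp add: mult.commute)
    have bm1: "b = 2" if "q k = -1" using that by (simp add: b_def)
    consider "t < tau k" | "tau k \<le> t" by linarith
    then have "b / 4 \<le> norm (y t) \<and> norm (y t) \<le> B * b"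
    proof cases
      case 1
      then have "norm (y t) \<in> I_int (q k)" using phase1 t by auto
      from I_int_bounds[OF this] have "b / 2 \<le> norm (y t)" "q k \<noteq> -1 \<Longrightarrow> norm (y t) \<le> b"
        by (auto simp: b_def)
      moreover from this have "norm (y t) \<le> B * b"
        using bm1 bB b_small \<open>b > 0\<close> by (cases "q k = -1") linarith+
      ultimately show ?thesis using \<open>b > 0\<close> by linarith
    next
      case 2
      then have J: "norm (y t) \<in> J_int (qhat k)" using phase2 t by auto
      have *: "b / 2 \<le> norm (y (tau k))" "q k \<noteq> -1 \<Longrightarrow> norm (y (tau k)) \<le> b"
        using attau_bounds[of k] by (auto simp: b_def)
      have b2: "b \<le> 2"
        using \<open>q k \<ge> -1\<close> powr_mono[of "- real_of_int (q k)" 1 2] by (simp add: b_def)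
      have low: "b / 4 \<le> norm (y t)"
        using J_int_ratio[OF st'(3)[of k] J] * b2 by auto
      have "norm (y t) \<le> B * b"
      proof (cases "q k \<ge> 1")
        case True
        then have "b \<le> 1/2"
          using powr_mono[of "- real_of_int (q k)" "-1" 2] by (simp add: b_def powr_minus)
        moreover have "norm (y (tau k)) \<le> b" using * True by auto
        ultimately show ?thesis
          using J_int_ratio[OF J st'(3)[of k]] b_small by auto
      next
        case False
        then have "b \<ge> 1"
          using powr_mono[of 0 "- real_of_int (q k)" 2] by (simp add: b_def)
        then show ?thesis by (rule bB)
      qed
      with low show ?thesis by blast
    qed
    then show ?thesis by (simp add: b_def)
  qed
  show ?thesis
  proof (intro exI[of _ B] conjI allI ballI)
    show "B > 0" using \<open>B \<ge> 2\<close> by simp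
    fix k t assume "t \<in> {lam k..<lam (Suc k)}"
    then show "0 \<le> t" "t < \<tau>" "2 powr (- real_of_int (q k)) / 4 \<le> norm (y t)"
      "norm (y t) \<le> B * 2 powr (- real_of_int (q k))"
      using main[of t k] lam[of k] lam_less[of "Suc k"] by auto
  qed
qed

section \<open>Local estimates for the solution\<close>

text \<open>
  The Young--Loeve estimate for each integrand \<open>\<sigma> j (y u)\<close>, which inherits a Hoelder constant from \<open>y\<close>
  because \<open>y\<close> stays in the region \<open>m \<le> norm \<xi>\<close> where \<open>\<sigma> j\<close> is Lipschitz. The path \<open>x\<close> may be measured with
  an exponent \<open>\<beta>\<close> other than \<open>\<gamma>\<close>; both \<open>\<gamma>\<close> and \<open>\<gamma>1\<close> will be used.
\<close>

lemma young_solution_increment_remainder: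
  fixes \<sigma> :: "'d::finite \<Rightarrow> real^'m \<Rightarrow> real^'m" and x :: "real \<Rightarrow> real^'d" and y :: "real \<Rightarrow> real^'m"
  assumes sol: "young_solution_until T \<gamma> \<sigma> x a y \<tau>"
    and lip: "\<And>j \<xi> \<eta>. m \<le> norm \<xi> \<Longrightarrow> m \<le> norm \<eta> \<Longrightarrow> norm (\<sigma> j \<xi> - \<sigma> j \<eta>) \<le> \<Lambda> * norm (\<xi> - \<eta>)"
    and "\<Lambda> \<ge> 0" "L \<ge> 0" "X \<ge> 0" "\<gamma> + \<beta> > 1"
    and st: "0 \<le> s" "s < t" "t < \<tau>"
    and away: "\<And>u. s \<le> u \<Longrightarrow> u \<le> t \<Longrightarrow> m \<le> norm (y u)"
    and yL: "\<And>u v. s \<le> u \<Longrightarrow> u < v \<Longrightarrow> v \<le> t \<Longrightarrow> norm (y v - y u) \<le> L * (v - u) powr \<gamma>"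
    and xX: "\<And>u v. s \<le> u \<Longrightarrow> u < v \<Longrightarrow> v \<le> t \<Longrightarrow> norm (x v - x u) \<le> X * (v - u) powr \<beta>"
  shows "norm (y t - y s - (\<Sum>j\<in>UNIV. (x t $ j - x s $ j) *\<^sub>R \<sigma> j (y s)))
    \<le> real CARD('d) * (\<Lambda> * L * X / (2 powr (\<gamma> + \<beta>) - 2)) * (t - s) powr (\<gamma> + \<beta>)"
proof -
  have ex: "\<exists>I. (\<forall>j. has_young_integral (\<lambda>u. \<sigma> j (y u)) (\<lambda>u. x u $ j) 0 r (I j)) \<and>
            y r = a + (\<Sum>j\<in>UNIV. I j)" if "0 \<le> r" "r < \<tau>" for r
    using sol that unfolding young_solution_until_def by auto
  obtain I where I: "\<And>j. has_young_integral (\<lambda>u. \<sigma> j (y u)) (\<lambda>u. x u $ j) 0 s (I j)"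
    "y s = a + (\<Sum>j\<in>UNIV. I j)"
    using ex[of s] st by auto
  obtain J where J: "\<And>j. has_young_integral (\<lambda>u. \<sigma> j (y u)) (\<lambda>u. x u $ j) 0 t (J j)"
    "y t = a + (\<Sum>j\<in>UNIV. J j)"
    using ex[of t] st by auto
  have "norm (J j - I j - (x t $ j - x s $ j) *\<^sub>R \<sigma> j (y s))
    \<le> \<Lambda> * L * X / (2 powr (\<gamma> + \<beta>) - 2) * (t - s) powr (\<gamma> + \<beta>)" (is "_ \<le> ?R") for j
  proof (rule young_integral_increment_bound[OF I(1) J(1)])
    fix u v assume uv: "s \<le> u" "u < v" "v \<le> t"
    have "norm (\<sigma> j (y v) - \<sigma> j (y u)) \<le> \<Lambda> * norm (y v - y u)"
      using uv by (intro lip away) auto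
    also have "\<dots> \<le> \<Lambda> * (L * (v - u) powr \<gamma>)"
      using uv \<open>\<Lambda> \<ge> 0\<close> by (intro mult_left_mono yL)
    finally show "norm (\<sigma> j (y v) - \<sigma> j (y u)) \<le> \<Lambda> * L * (v - u) powr \<gamma>"
      by (simp add: mult.assoc)
    show "\<bar>x v $ j - x u $ j\<bar> \<le> X * (v - u) powr \<beta>"
      using xX[OF uv] component_le_norm_cart[of "x v - x u" j] by simp
  qed (use st assms in auto)
  then have "norm (\<Sum>j\<in>UNIV. J j - I j - (x t $ j - x s $ j) *\<^sub>R \<sigma> j (y s)) \<le> (\<Sum>j\<in>(UNIV::'d set). ?R)"
    by (intro sum_norm_le)
  then show ?thesis
    by (simp add: I(2) J(2) sum_subtractf mult.assoc)
qed

theorem proposition4p6: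
  fixes T \<gamma> \<kappa> \<epsilon>1 \<gamma>1 \<alpha> \<tau> :: real
    and \<sigma> :: "'d::finite \<Rightarrow> real^'m \<Rightarrow> real^'m"
    and x :: "real \<Rightarrow> real^'d"
    and a :: "real^'m"
    and y :: "real \<Rightarrow> real^'m"
    and lam tau :: "nat \<Rightarrow> real"
    and q qhat :: "nat \<Rightarrow> int"
  assumes "T > 0"
    and "1/2 < \<gamma>" and "\<gamma> < 1"
    and "0 < \<kappa>" and "\<kappa> < 1"
    and "\<gamma> * (\<kappa> + 1) < 1"
    and "\<And>j. power_type_coefficient \<gamma> \<kappa> (\<sigma> j)"
    and "holder_on \<gamma> {0..T} x"
    and "a \<noteq> 0"
    and "young_solution_until T \<gamma> \<sigma> x a y \<tau>"
    and "stopping_times T y lam q tau qhat"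
    and "\<epsilon>1 > 0" and "\<gamma>1 = \<gamma> + \<epsilon>1"
    and "holder_seminorm \<gamma>1 {0..T} x < \<infinity>"
    and "\<gamma>1 + \<gamma> * \<kappa> < 1"
    and "\<alpha> = (1 - \<kappa>) / \<gamma>"
  shows "\<exists>c0 c1. c0 > 0 \<and> c1 > 0 \<and>
    (\<forall>k. \<forall>s\<in>{lam k..<lam (Suc k)}. \<forall>t\<in>{lam k..<lam (Suc k)}.
       \<bar>t - s\<bar> \<le> c0 * 2 powr (- \<alpha> * real_of_int (q k)) \<longrightarrow>
       norm (y t - y s) \<le> c1 * 2 powr (- real_of_int (q k) * \<kappa>) * \<bar>t - s\<bar> powr \<gamma>) \<and>
    (\<exists>c2. \<forall>k. \<forall>s\<in>{lam k..<lam (Suc k)}. \<forall>t\<in>{lam k..<lam (Suc k)}.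
       s < t \<and> \<bar>t - s\<bar> \<le> c0 * 2 powr (- \<alpha> * real_of_int (q k)) \<longrightarrow>
       (\<exists>r. y t - y s = (\<Sum>j\<in>UNIV. (x t $ j - x s $ j) *\<^sub>R \<sigma> j (y s)) + r \<and>
            norm r \<le> c2 * 2 powr (- (\<kappa> + \<epsilon>1 * \<alpha>) * real_of_int (q k)) * \<bar>t - s\<bar> powr \<gamma>))"
proof -
  note \<gamma> = \<open>1/2 < \<gamma>\<close> and \<kappa> = \<open>0 < \<kappa>\<close> \<open>\<kappa> < 1\<close> and sol = \<open>young_solution_until T \<gamma> \<sigma> x a y \<tau>\<close>
  have \<alpha>\<gamma>: "\<alpha> * \<gamma> = 1 - \<kappa>"
    using assms(16) \<gamma> by simp
  have \<alpha>\<gamma>1: "\<alpha> * \<gamma>1 = 1 - \<kappa> + \<epsilon>1 * \<alpha>"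
    unfolding \<open>\<gamma>1 = \<gamma> + \<epsilon>1\<close> distrib_left \<alpha>\<gamma> by (simp only: mult.commute)
  obtain C where C: "C > 0" "\<And>j \<xi>. norm (\<sigma> j \<xi>) \<le> C * norm \<xi> powr \<kappa>"
    "\<And>j \<xi> \<eta> m. 0 < m \<Longrightarrow> m \<le> norm \<xi> \<Longrightarrow> m \<le> norm \<eta> \<Longrightarrow>
       norm (\<sigma> j \<xi> - \<sigma> j \<eta>) \<le> C * m powr (\<kappa> - 1) * norm (\<xi> - \<eta>)"
    by (rule power_type_coefficients_bounds[of \<gamma> \<kappa> \<sigma>, OF assms(7) \<kappa>]) blast
  obtain X where X: "X > 0" "\<And>s t. s \<in> {0..T} \<Longrightarrow> t \<in> {0..T} \<Longrightarrow> dist (x s) (x t) \<le> X * dist s t powr \<gamma>"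
    by (rule holder_onE[OF \<open>holder_on \<gamma> {0..T} x\<close>]) blast
  have "holder_on \<gamma>1 {0..T} x"
    using assms(14) by (simp add: holder_on_def)
  then obtain X1 where X1: "X1 > 0"
    "\<And>s t. s \<in> {0..T} \<Longrightarrow> t \<in> {0..T} \<Longrightarrow> dist (x s) (x t) \<le> X1 * dist s t powr \<gamma>1"
    by (rule holder_onE) blast
  have \<tau>: "0 < \<tau>" "\<tau> < T"
    using sol by (auto simp: young_solution_until_def)
  have xX: "norm (x v - x u) \<le> X * (v - u) powr \<gamma>" "norm (x v - x u) \<le> X1 * (v - u) powr \<gamma>1"
    if "0 \<le> u" "u < v" "v < \<tau>" for u v
    using X(2)[of v u] X1(2)[of v u] that \<tau> by (auto simp: dist_norm)
  have cont: "continuous_on {0..T} y" and zero: "\<And>t. t \<in> {\<tau>..T} \<Longrightarrow> y t = 0"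
    using sol by (auto simp: young_solution_until_def)
  obtain B where B: "B > 0"
    "\<And>k t. t \<in> {lam k..<lam (Suc k)} \<Longrightarrow> 0 \<le> t \<and> t < \<tau> \<and>
       2 powr (- real_of_int (q k)) / 4 \<le> norm (y t) \<and>
       norm (y t) \<le> B * 2 powr (- real_of_int (q k))"
    using solution_size_between_stopping_times[OF cont \<tau> zero \<open>stopping_times T y lam q tau qhat\<close>]
    by blast
  \<comment> \<open>On the \<open>k\<close>-th interval \<open>\<Lambda> k\<close> is a Lipschitz constant of the coefficients. The constants \<open>D\<close> and \<open>D1\<close> are
    what remains of the remainder bound for the exponents \<open>\<gamma>\<close> and \<open>\<gamma>1\<close> of \<open>x\<close> once the powers of
    \<open>b k\<close> are split off, \<open>A\<close> is the same for the first-order term, and \<open>c0\<close> is chosen such that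
    \<open>D * c0 powr \<gamma> = 1 / 2\<close>.\<close>
  define n where "n = real CARD('d)"
  define b where "b k = 2 powr (- real_of_int (q k))" for k
  define \<Lambda> where "\<Lambda> k = C * (b k / 4) powr (\<kappa> - 1)" for k
  define D where "D = n * (C * (1/4) powr (\<kappa> - 1) * X / (2 powr (\<gamma> + \<gamma>) - 2))"
  define D1 where "D1 = n * (C * (1/4) powr (\<kappa> - 1) * X1 / (2 powr (\<gamma> + \<gamma>1) - 2))"
  define A where "A = n * (X * (C * B powr \<kappa>))"
  define c0 where "c0 = (1 / (2 * D)) powr (1 / \<gamma>)"
  define c1 where "c1 = 2 * A"
  define c2 where "c2 = D1 * c1 * c0 powr \<gamma>1"
  have n: "n > 0" by (simp add: n_def)
  have b: "b k > 0" for k by (simp add: b_def)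
  have "1 < \<gamma> + \<gamma>" "1 < \<gamma> + \<gamma>1"
    using \<gamma> assms(12,13) by auto
  then have "2 powr 1 < 2 powr (\<gamma> + \<gamma>)" "2 powr 1 < 2 powr (\<gamma> + \<gamma>1)"
    by (simp_all only: powr_less_cancel_iff)
  then have "2 powr (\<gamma> + \<gamma>) - 2 > 0" "2 powr (\<gamma> + \<gamma>1) - 2 > 0"
    by simp_all
  then have pos: "D > 0" "D1 > 0" "A > 0"
    unfolding D_def D1_def A_def using n C(1) X(1) X1(1) B(1)
    by (intro mult_pos_pos divide_pos_pos; simp)+
  have c0: "c0 > 0" "c0 powr \<gamma> = 1 / (2 * D)"
    using pos \<gamma> by (auto simp: c0_def powr_powr)
  have "c1 > 0" using pos by (simp add: c1_def)
  have \<Lambda>: "\<Lambda> k \<ge> 0" "\<Lambda> k = C * (1/4) powr (\<kappa> - 1) * b k powr (\<kappa> - 1)" for k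
    using C(1) powr_mult[of "b k" "1/4" "\<kappa> - 1"] b[of k] by (auto simp: \<Lambda>_def)
  have scale: "h powr \<gamma> \<le> b k powr (1 - \<kappa>) / (2 * D)"
    "h powr \<gamma>1 \<le> c0 powr \<gamma>1 * b k powr (1 - \<kappa> + \<epsilon>1 * \<alpha>)"
    if "0 \<le> h" "h \<le> c0 * b k powr \<alpha>" for h k
  proof -
    have "h powr \<gamma> \<le> (c0 * b k powr \<alpha>) powr \<gamma>" "h powr \<gamma>1 \<le> (c0 * b k powr \<alpha>) powr \<gamma>1"
      using that \<gamma> assms(12,13) by (auto intro!: powr_mono2)
    moreover have "(c0 * b k powr \<alpha>) powr \<gamma> = b k powr (1 - \<kappa>) / (2 * D)"
      using c0 by (simp add: powr_mult powr_powr \<alpha>\<gamma>)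
    moreover have "(c0 * b k powr \<alpha>) powr \<gamma>1 = c0 powr \<gamma>1 * b k powr (1 - \<kappa> + \<epsilon>1 * \<alpha>)"
      using c0 by (simp add: powr_mult powr_powr \<alpha>\<gamma>1)
    ultimately show "h powr \<gamma> \<le> b k powr (1 - \<kappa>) / (2 * D)"
      "h powr \<gamma>1 \<le> c0 powr \<gamma>1 * b k powr (1 - \<kappa> + \<epsilon>1 * \<alpha>)" by auto
  qed
  have remainder: "norm (y v - y u - (\<Sum>j\<in>UNIV. (x v $ j - x u $ j) *\<^sub>R \<sigma> j (y u)))
      \<le> n * (\<Lambda> k * L * Z / (2 powr (\<gamma> + \<beta>) - 2)) * (v - u) powr (\<gamma> + \<beta>)"
    if uv: "lam k \<le> u" "u < v" "v < lam (Suc k)" and "L \<ge> 0" "Z > 0" "\<gamma> + \<beta> > 1"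
      and yL: "\<And>u' v'. u \<le> u' \<Longrightarrow> u' < v' \<Longrightarrow> v' \<le> v \<Longrightarrow> norm (y v' - y u') \<le> L * (v' - u') powr \<gamma>"
      and xZ: "\<And>u v. 0 \<le> u \<Longrightarrow> u < v \<Longrightarrow> v < \<tau> \<Longrightarrow> norm (x v - x u) \<le> Z * (v - u) powr \<beta>"
    for k u v L Z \<beta>
  proof -
    have "0 \<le> u" "v < \<tau>" using B(2)[of u k] B(2)[of v k] uv by auto
    show ?thesis
      unfolding n_def
    proof (rule young_solution_increment_remainder[OF sol, where m = "b k / 4"])
      show "norm (\<sigma> j \<xi> - \<sigma> j \<eta>) \<le> \<Lambda> k * norm (\<xi> - \<eta>)"
        if "b k / 4 \<le> norm \<xi>" "b k / 4 \<le> norm \<eta>" for j \<xi> \<eta>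
        unfolding \<Lambda>_def using that b[of k] by (intro C(3)) auto
      show "b k / 4 \<le> norm (y w)" if "u \<le> w" "w \<le> v" for w
        using B(2)[of w k] that uv by (auto simp: b_def)
      show "norm (x v' - x u') \<le> Z * (v' - u') powr \<beta>" if "u \<le> u'" "u' < v'" "v' \<le> v" for u' v'
        using that \<open>0 \<le> u\<close> \<open>v < \<tau>\<close> by (intro xZ) auto
    qed (use that \<Lambda> yL \<open>0 \<le> u\<close> \<open>v < \<tau>\<close> in auto)
  qed
  have holder: "norm (y t - y s) \<le> c1 * b k powr \<kappa> * (t - s) powr \<gamma>"
    if st: "lam k \<le> s" "s < t" "t < lam (Suc k)" "t - s \<le> c0 * b k powr \<alpha>" for k s t
  proof -
    have st0: "0 \<le> s" "t < \<tau>" using B(2)[of s k] B(2)[of t k] st by auto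
    have "holder_on \<gamma> {0..t} y"
      using sol st st0 unfolding young_solution_until_def by auto
    then obtain L0 where L0: "\<And>u v. u \<in> {0..t} \<Longrightarrow> v \<in> {0..t} \<Longrightarrow> dist (y u) (y v) \<le> L0 * dist u v powr \<gamma>"
      by (rule holder_onE) blast
    have "norm (y t - y s) \<le> 2 * (A * b k powr \<kappa>) * (t - s) powr \<gamma>"
    proof (rule holder_bound_absorb[where f = y and M = L0 and s = s and t = t])
      show "norm (y v - y u) \<le> L0 * (v - u) powr \<gamma>" if "s \<le> u" "u < v" "v \<le> t" for u v
        using L0[of v u] that st0 by (auto simp: dist_norm)
    next
      fix L u v
      assume "L \<ge> 0" and uv: "s \<le> u" "u < v" "v \<le> t"
        and L: "\<And>u v. s \<le> u \<Longrightarrow> u < v \<Longrightarrow> v \<le> t \<Longrightarrow> norm (y v - y u) \<le> L * (v - u) powr \<gamma>"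
      define h where "h = v - u"
      have h: "h > 0" "h \<le> c0 * b k powr \<alpha>" using uv st by (auto simp: h_def)
      have "norm (y v - y u - (\<Sum>j\<in>UNIV. (x v $ j - x u $ j) *\<^sub>R \<sigma> j (y u)))
          \<le> n * (\<Lambda> k * L * X / (2 powr (\<gamma> + \<gamma>) - 2)) * h powr (\<gamma> + \<gamma>)"
        unfolding h_def
      proof (rule remainder)
        show "norm (y v' - y u') \<le> L * (v' - u') powr \<gamma>" if "u \<le> u'" "u' < v'" "v' \<le> v" for u' v'
          using that uv by (intro L) auto
      qed (use uv st \<open>L \<ge> 0\<close> X(1) \<gamma> xX(1) in auto)
      also have "\<dots> = D * L * h powr \<gamma> * (b k powr (\<kappa> - 1) * h powr \<gamma>)"
        unfolding \<Lambda>(2) D_def powr_add[of h] by simp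
      also have "\<dots> \<le> D * L * h powr \<gamma> * (b k powr (\<kappa> - 1) * (b k powr (1 - \<kappa>) / (2 * D)))"
        using scale(1)[of h k] h pos \<open>L \<ge> 0\<close> by (intro mult_left_mono) auto
      also have "b k powr (\<kappa> - 1) * (b k powr (1 - \<kappa>) / (2 * D)) = 1 / (2 * D)"
        using b[of k] by (simp add: powr_add[symmetric])
      also have "D * L * h powr \<gamma> * (1 / (2 * D)) = L / 2 * h powr \<gamma>"
        using pos by simp
      finally have 1: "norm (y v - y u - (\<Sum>j\<in>UNIV. (x v $ j - x u $ j) *\<^sub>R \<sigma> j (y u)))
          \<le> L / 2 * h powr \<gamma>" .
      have "norm ((x v $ j - x u $ j) *\<^sub>R \<sigma> j (y u)) \<le> (X * h powr \<gamma>) * (C * (B powr \<kappa> * b k powr \<kappa>))" for j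
        unfolding norm_scaleR
      proof (intro mult_mono)
        show "\<bar>x v $ j - x u $ j\<bar> \<le> X * h powr \<gamma>"
          using component_le_norm_cart[of "x v - x u" j] xX(1)[of u v] uv st0 by (simp add: h_def)
        have "norm (\<sigma> j (y u)) \<le> C * norm (y u) powr \<kappa>" by (rule C(2))
        also have "\<dots> \<le> C * (B * b k) powr \<kappa>"
          using B(2)[of u k] uv st C(1) \<kappa> by (intro mult_left_mono powr_mono2) (auto simp: b_def)
        finally show "norm (\<sigma> j (y u)) \<le> C * (B powr \<kappa> * b k powr \<kappa>)"
          using B(1) b[of k] by (simp add: powr_mult)
      qed (use X(1) in auto)
      then have "norm (\<Sum>j\<in>UNIV. (x v $ j - x u $ j) *\<^sub>R \<sigma> j (y u))
          \<le> (\<Sum>j\<in>(UNIV::'d set). (X * h powr \<gamma>) * (C * (B powr \<kappa> * b k powr \<kappa>)))"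
        by (intro sum_norm_le)
      also have "\<dots> = A * b k powr \<kappa> * h powr \<gamma>"
        by (simp add: A_def n_def)
      finally have "norm (y v - y u) \<le> A * b k powr \<kappa> * h powr \<gamma> + L / 2 * h powr \<gamma>"
        using 1 norm_triangle_sub[of "y v - y u" "\<Sum>j\<in>UNIV. (x v $ j - x u $ j) *\<^sub>R \<sigma> j (y u)"]
        by linarith
      then show "norm (y v - y u) \<le> (A * b k powr \<kappa> + L / 2) * (v - u) powr \<gamma>"
        by (simp add: h_def algebra_simps)
    qed (use st in auto)
    then show ?thesis by (simp add: c1_def mult.assoc)
  qed
  have expansion: "norm (y t - y s - (\<Sum>j\<in>UNIV. (x t $ j - x s $ j) *\<^sub>R \<sigma> j (y s)))
      \<le> c2 * b k powr (\<kappa> + \<epsilon>1 * \<alpha>) * (t - s) powr \<gamma>"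
    if st: "lam k \<le> s" "s < t" "t < lam (Suc k)" "t - s \<le> c0 * b k powr \<alpha>" for k s t
  proof -
    define h where "h = t - s"
    have h: "h > 0" "h \<le> c0 * b k powr \<alpha>" using st by (auto simp: h_def)
    have "norm (y t - y s - (\<Sum>j\<in>UNIV. (x t $ j - x s $ j) *\<^sub>R \<sigma> j (y s)))
        \<le> n * (\<Lambda> k * (c1 * b k powr \<kappa>) * X1 / (2 powr (\<gamma> + \<gamma>1) - 2)) * h powr (\<gamma> + \<gamma>1)"
      unfolding h_def
    proof (rule remainder)
      show "norm (y v' - y u') \<le> c1 * b k powr \<kappa> * (v' - u') powr \<gamma>"
        if "s \<le> u'" "u' < v'" "v' \<le> t" for u' v'
        using that st by (intro holder) auto
    qed (use st \<open>c1 > 0\<close> X1(1) \<gamma> xX(2) assms(12,13) in auto)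
    also have "\<dots> = D1 * c1 * h powr \<gamma> * (b k powr (\<kappa> - 1) * b k powr \<kappa> * h powr \<gamma>1)"
      unfolding \<Lambda>(2) D1_def powr_add[of h] by simp
    also have "\<dots> \<le> D1 * c1 * h powr \<gamma> * (b k powr (\<kappa> - 1) * b k powr \<kappa> *
        (c0 powr \<gamma>1 * b k powr (1 - \<kappa> + \<epsilon>1 * \<alpha>)))"
      using scale(2)[of h k] h pos \<open>c1 > 0\<close> by (intro mult_left_mono) auto
    also have "\<dots> = c2 * (b k powr (\<kappa> - 1) * b k powr \<kappa> * b k powr (1 - \<kappa> + \<epsilon>1 * \<alpha>)) * h powr \<gamma>"
      by (simp add: c2_def)
    also have "b k powr (\<kappa> - 1) * b k powr \<kappa> * b k powr (1 - \<kappa> + \<epsilon>1 * \<alpha>) = b k powr (\<kappa> + \<epsilon>1 * \<alpha>)"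
      by (simp add: powr_add[symmetric])
    finally show ?thesis by (simp add: h_def)
  qed
  have b_powr: "b k powr p = 2 powr (- p * real_of_int (q k))" for k p
    by (simp add: b_def powr_powr mult.commute)
  show ?thesis
  proof (rule exI[of _ c0], rule exI[of _ c1], intro conjI allI ballI impI)
    fix k s t
    assume s: "s \<in> {lam k..<lam (Suc k)}" and t: "t \<in> {lam k..<lam (Suc k)}"
      and "\<bar>t - s\<bar> \<le> c0 * 2 powr (- \<alpha> * real_of_int (q k))"
    then have d: "\<bar>t - s\<bar> \<le> c0 * b k powr \<alpha>" by (simp add: b_powr)
    consider "s < t" | "s = t" | "t < s" by linarith
    then have "norm (y t - y s) \<le> c1 * b k powr \<kappa> * \<bar>t - s\<bar> powr \<gamma>"
    proof cases
      case 1
      then show ?thesis using holder[of k s t] s t d by simp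
    next
      case 3
      then show ?thesis using holder[of k t s] s t d by (simp add: norm_minus_commute)
    qed simp
    then show "norm (y t - y s) \<le> c1 * 2 powr (- real_of_int (q k) * \<kappa>) * \<bar>t - s\<bar> powr \<gamma>"
      by (simp add: b_powr mult.commute)
  next
    show "\<exists>c2. \<forall>k. \<forall>s\<in>{lam k..<lam (Suc k)}. \<forall>t\<in>{lam k..<lam (Suc k)}.
       s < t \<and> \<bar>t - s\<bar> \<le> c0 * 2 powr (- \<alpha> * real_of_int (q k)) \<longrightarrow>
       (\<exists>r. y t - y s = (\<Sum>j\<in>UNIV. (x t $ j - x s $ j) *\<^sub>R \<sigma> j (y s)) + r \<and>
            norm r \<le> c2 * 2 powr (- (\<kappa> + \<epsilon>1 * \<alpha>) * real_of_int (q k)) * \<bar>t - s\<bar> powr \<gamma>)"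
    proof (rule exI[of _ c2], intro allI ballI impI)
      fix k s t
      assume s: "s \<in> {lam k..<lam (Suc k)}" and t: "t \<in> {lam k..<lam (Suc k)}"
        and d: "s < t \<and> \<bar>t - s\<bar> \<le> c0 * 2 powr (- \<alpha> * real_of_int (q k))"
      then have "norm (y t - y s - (\<Sum>j\<in>UNIV. (x t $ j - x s $ j) *\<^sub>R \<sigma> j (y s)))
          \<le> c2 * b k powr (\<kappa> + \<epsilon>1 * \<alpha>) * \<bar>t - s\<bar> powr \<gamma>"
        using expansion[of k s t] by (auto simp: b_powr)
      then show "\<exists>r. y t - y s = (\<Sum>j\<in>UNIV. (x t $ j - x s $ j) *\<^sub>R \<sigma> j (y s)) + r \<and>
              norm r \<le> c2 * 2 powr (- (\<kappa> + \<epsilon>1 * \<alpha>) * real_of_int (q k)) * \<bar>t - s\<bar> powr \<gamma>"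
        unfolding b_powr
        by (intro exI[of _ "y t - y s - (\<Sum>j\<in>UNIV. (x t $ j - x s $ j) *\<^sub>R \<sigma> j (y s))"]) simp
    qed
  qed (use c0 \<open>c1 > 0\<close> in auto)
qed

end
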